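(* Let $\mathcal X,\mathcal Y$ be complex Hilbert spaces and let $P(\lambda)=\lambda E-BQ$, where $E$ and $Q$ are bounded linear operators from $\mathcal X$ to $\mathcal Y$, $Q$ is boundedly invertible, $Q^*E$ is selfadjoint and nonnegative (i.e. $\langle Q^*Ex,x\rangle\ge 0$ for all $x\in\mathcal X$), and $B$ is a closed, densely defined, dissipative operator in $\mathcal Y$. Then the following conditions are equivalent: (a) $s_{\mathrm p}(P(\lambda))=\mathbb C$ and $\infty$ is a point singularity of $P(\lambda)$; (b) $s_{\mathrm p}(P(\lambda))\cap\{\lambda_0\in\mathbb C:\operatorname{Re}\lambda_0>0\}\ne\emptyset$; (c) $\ker E\cap\ker(BQ)\ne\{0\}$; (d) the pencil $P(\lambda)$ has a right singular polynomial.
   Context: Dissipative means $\operatorname{Re}\langle Bx,x\rangle\le 0$ for all $x\in\mathcal D(B)\subseteq\mathcal Y$. The operator $BQ$ has domain $\mathcal D(BQ)=\{x\in\mathcal X: Qx\in\mathcal D(B)\}$. For a pencil $P(\lambda)=\lambda E-A$ (here $A=BQ$), $P(\lambda_0)$ denotes the operator $\lambda_0E-A$. The set $s_{\mathrm p}(P(\lambda))\subseteq\mathbb C$ of point singularities consists of all $\lambda_0\in\mathbb C$ for which there is $x\in\mathcal D(P(\lambda_0))\setminus\{0\}$ with $P(\lambda_0)x=0$. The point $\infty$ is a point singularity of $P(\lambda)$ if $0$ is a point singularity of the reversal pencil $\lambda A-E$, i.e. if $\ker E\ne\{0\}$. A right singular polynomial for $\lambda E-A$ is a nonzero $\mathcal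 X$-valued polynomial $p(\lambda)=\sum_{j=0}^k\lambda^ja_j$ ($a_j\in\mathcal X$) such that $p(\lambda_0)\in\mathcal D(E)\cap\mathcal D(A)$ and $(\lambda_0E-A)p(\lambda_0)=0$ for every $\lambda_0\in\mathbb C$. *)

theory Defs
  imports "HOL-Analysis.Analysis" "HOL-Computational_Algebra.Polynomial"
begin

section \<open>Complex Hilbert spaces\<close>

text \<open>
  The complex inner product is linear in its first argument. The real inner product of the
  underlying class is its real part, so norm, topology and completeness are those induced by it.
\<close>

class complex_inner = real_inner +
  fixes scaleC :: "complex \<Rightarrow> 'a \<Rightarrow> 'a" (infixr "*\<^sub>C" 75)
    and cinner :: "'a \<Rightarrow> 'a \<Rightarrow> complex"
  assumes scaleC_of_real: "complex_of_real r *\<^sub>C x = r *\<^sub>R x"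
    and scaleC_add_right: "c *\<^sub>C (x + y) = c *\<^sub>C x + c *\<^sub>C y"
    and scaleC_add_left: "(c + d) *\<^sub>C x = c *\<^sub>C x + d *\<^sub>C x"
    and scaleC_scaleC: "c *\<^sub>C d *\<^sub>C x = (c * d) *\<^sub>C x"
    and cinner_add_left: "cinner (x + y) z = cinner x z + cinner y z"
    and cinner_scaleC_left: "cinner (c *\<^sub>C x) y = c * cinner x y"
    and cinner_commute: "cinner x y = cnj (cinner y x)"
    and inner_eq_Re_cinner: "inner x y = Re (cinner x y)"

class complex_hilbert = complex_inner + complete_space

instantiation complex :: complex_hilbert
begin

definition scaleC_complex :: "complex \<Rightarrow> complex \<Rightarrow> complex"
  where "scaleC_complex c x = c * x"

definition cinner_complex :: "complex \<Rightarrow> complex \<Rightarrow> complex"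
  where "cinner_complex x y = x * cnj y"

instance
  by standard
    (simp_all add: scaleC_complex_def cinner_complex_def algebra_simps inner_complex_def
      scaleR_conv_of_real)

end

section \<open>Bounded operators\<close>

definition bounded_clinear :: "('a::complex_inner \<Rightarrow> 'b::complex_inner) \<Rightarrow> bool"
  where "bounded_clinear T \<longleftrightarrow> bounded_linear T \<and> (\<forall>c x. T (c *\<^sub>C x) = c *\<^sub>C T x)"

definition boundedly_invertible :: "('a::complex_inner \<Rightarrow> 'b::complex_inner) \<Rightarrow> bool"
  where "boundedly_invertible T \<longleftrightarrow>
    (\<exists>S. bounded_clinear S \<and> (\<forall>x. S (T x) = x) \<and> (\<forall>y. T (S y) = y))"

text \<open>
  For a bounded operator between Hilbert spaces the adjoint exists and is unique; the choice
  operator is used as in the library constant \<^const>\<open>adjoint\<close> for real inner product spaces.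
\<close>

definition cadjoint :: "('a::complex_inner \<Rightarrow> 'b::complex_inner) \<Rightarrow> 'b \<Rightarrow> 'a"
  where "cadjoint T = (SOME S. \<forall>x y. cinner (T x) y = cinner x (S y))"

definition selfadjoint :: "('a::complex_inner \<Rightarrow> 'a) \<Rightarrow> bool"
  where "selfadjoint T \<longleftrightarrow> bounded_clinear T \<and> cadjoint T = T"

text \<open>Membership in \<^term>\<open>\<real>\<^sub>\<ge>\<^sub>0 :: complex set\<close> means being real and nonnegative.\<close>

definition nonnegative :: "('a::complex_inner \<Rightarrow> 'a) \<Rightarrow> bool"
  where "nonnegative T \<longleftrightarrow> (\<forall>x. cinner (T x) x \<in> \<real>\<^sub>\<ge>\<^sub>0)"

section \<open>Unbounded operators\<close>

text \<open>
  A not necessarily everywhere defined operator is a partial map \<open>T :: 'a \<rightharpoonup> 'b\<close> with domain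
  \<open>dom T\<close>. An everywhere defined \<open>Q\<close> is embedded as \<open>Some \<circ> Q\<close>, and the product of a partial
  \<open>B\<close> with an everywhere defined \<open>Q\<close> is \<open>B \<circ> Q\<close>, whose domain is \<open>{x. Q x \<in> dom B}\<close>.
\<close>

definition linear_op :: "('a::complex_inner \<rightharpoonup> 'b::complex_inner) \<Rightarrow> bool"
  where "linear_op T \<longleftrightarrow>
    T 0 = Some 0 \<and>
    (\<forall>x y u v. T x = Some u \<longrightarrow> T y = Some v \<longrightarrow> T (x + y) = Some (u + v)) \<and>
    (\<forall>c x u. T x = Some u \<longrightarrow> T (c *\<^sub>C x) = Some (c *\<^sub>C u))"

definition closed_op :: "('a::complex_inner \<rightharpoonup> 'b::complex_inner) \<Rightarrow> bool"
  where "closed_op T \<longleftrightarrow> closed (Map.graph T)"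

definition densely_defined :: "('a::complex_inner \<rightharpoonup> 'b::complex_inner) \<Rightarrow> bool"
  where "densely_defined T \<longleftrightarrow> closure (dom T) = UNIV"

definition dissipative :: "('a::complex_inner \<rightharpoonup> 'a) \<Rightarrow> bool"
  where "dissipative T \<longleftrightarrow> (\<forall>x\<in>dom T. Re (cinner (the (T x)) x) \<le> 0)"

definition ker_op :: "('a::complex_inner \<rightharpoonup> 'b::complex_inner) \<Rightarrow> 'a set"
  where "ker_op T = {x \<in> dom T. the (T x) = 0}"

text \<open>By convention \<open>0 \<cdot> T\<close> is the everywhere defined zero operator, so that the reversal pencil
  \<open>\<lambda> A - E\<close> at \<open>\<lambda> = 0\<close> is \<open>- E\<close> on all of \<open>dom E\<close>, not only on \<open>dom E \<inter> dom A\<close>.\<close>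

definition scale_op :: "complex \<Rightarrow> ('a::complex_inner \<rightharpoonup> 'b::complex_inner) \<Rightarrow> ('a \<rightharpoonup> 'b)"
  where "scale_op c T = (if c = 0 then (\<lambda>x. Some 0) else (\<lambda>x. map_option (\<lambda>u. c *\<^sub>C u) (T x)))"

definition diff_op ::
    "('a::complex_inner \<rightharpoonup> 'b::complex_inner) \<Rightarrow> ('a \<rightharpoonup> 'b) \<Rightarrow> ('a \<rightharpoonup> 'b)"
  where "diff_op S T =
    (\<lambda>x. if x \<in> dom S \<inter> dom T then Some (the (S x) - the (T x)) else None)"

section \<open>Operator pencils\<close>

definition pencil ::
    "('a::complex_inner \<rightharpoonup> 'b::complex_inner) \<Rightarrow> ('a \<rightharpoonup> 'b) \<Rightarrow> complex \<Rightarrow> ('a \<rightharpoonup> 'b)"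
  where "pencil E A z = diff_op (scale_op z E) A"

definition point_singularities ::
    "('a::complex_inner \<rightharpoonup> 'b::complex_inner) \<Rightarrow> ('a \<rightharpoonup> 'b) \<Rightarrow> complex set"
  where "point_singularities E A =
    {z. \<exists>x \<in> dom (pencil E A z) - {0}. the (pencil E A z x) = 0}"

definition infinity_point_singularity ::
    "('a::complex_inner \<rightharpoonup> 'b::complex_inner) \<Rightarrow> ('a \<rightharpoonup> 'b) \<Rightarrow> bool"
  where "infinity_point_singularity E A \<longleftrightarrow> 0 \<in> point_singularities A E"

lemma infinity_point_singularity_iff_ker_op:
  assumes "linear_op E"
  shows "infinity_point_singularity E A \<longleftrightarrow> ker_op E \<noteq> {0}"
  using assms
  unfolding infinity_point_singularity_def point_singularities_def pencil_def diff_op_def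
    scale_op_def ker_op_def linear_op_def dom_def
  by (auto split: if_splits)

text \<open>
  A vector-valued polynomial is an element of \<open>'a poly\<close>; the library evaluation \<^const>\<open>poly\<close>
  does not apply because scalars and coefficients have different types.
\<close>

definition vpoly :: "'a::complex_inner poly \<Rightarrow> complex \<Rightarrow> 'a"
  where "vpoly p z = (\<Sum>j\<le>degree p. z ^ j *\<^sub>C coeff p j)"

definition right_singular_poly ::
    "('a::complex_inner \<rightharpoonup> 'b::complex_inner) \<Rightarrow> ('a \<rightharpoonup> 'b) \<Rightarrow> 'a poly \<Rightarrow> bool"
  where "right_singular_poly E A p \<longleftrightarrow>
    p \<noteq> 0 \<and>
    (\<forall>z. vpoly p z \<in> dom E \<inter> dom A \<and> the (pencil E A z (vpoly p z)) = 0)"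

end

theory Submission
  imports Defs
begin

text \<open>
  Everything rests on one computation. If \<open>z E x = B (Q x)\<close> with \<open>Re z > 0\<close>, then pairing both sides
  with \<open>Q x\<close> gives \<open>z \<langle>Q\<^sup>* E x, x\<rangle> = \<langle>B Q x, Q x\<rangle>\<close>. The right-hand side has nonpositive real part
  by dissipativity, while \<open>\<langle>Q\<^sup>* E x, x\<rangle> \<ge> 0\<close>; hence \<open>\<langle>Q\<^sup>* E x, x\<rangle> = 0\<close>. A symmetric nonnegative
  operator kills every vector on which its quadratic form vanishes, so \<open>Q\<^sup>* E x = 0\<close>, and \<open>E x = 0\<close>
  because \<open>Q\<close> is onto. Then also \<open>B (Q x) = z E x = 0\<close>: an eigenvector in the open right half-plane
  already lies in the common kernel of \<open>E\<close> and \<open>B Q\<close>. This is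
  \<open>singular_vector_in_right_half_plane\<close>.

  Conversely, a common kernel vector is singular for every \<open>z\<close> and at infinity, and it is a constant
  right singular polynomial. An arbitrary right singular polynomial has only finitely many zeros
  (\<open>finite_zeros_vpoly\<close>), so one of its values is a nonzero singular vector for some \<open>z\<close> with
  \<open>Re z > 0\<close>.

  The adjoint is introduced by a choice operator, so all of this requires that bounded operators
  do have adjoints. This is derived from the Riesz representation theorem for real Hilbert spaces,
  applied to the real part of the inner product.
\<close>

section \<open>Riesz representation and existence of adjoints\<close>

lemma linear_coeff_zero_if_quadratic_nonneg:
  fixes a b :: real
  assumes nonneg: "\<And>t. 0 \<le> t * b + t\<^sup>2 * a"
  shows "b = 0"
proof (rule ccontr)
  assume "b \<noteq> 0"
  define s where "s = \<bar>a\<bar> + 1"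
  have s: "s > 0" "a < s" by (auto simp: s_def)
  have "0 \<le> - (b / s) * b + (- (b / s))\<^sup>2 * a" by (rule nonneg)
  also have "\<dots> = (b / s)\<^sup>2 * (a - s)"
    using s by (simp add: power2_eq_square field_simps)
  also have "\<dots> < 0"
    using s \<open>b \<noteq> 0\<close> by (simp add: mult_pos_neg)
  finally show False by simp
qed

text \<open>
  The representing vector is the minimiser of the energy \<open>\<parallel>x\<parallel>\<^sup>2 / 2 - f x\<close>: the parallelogram law
  makes every minimising sequence Cauchy, and the first variation of the energy at its minimiser
  vanishes, which is the desired identity.
\<close>

lemma riesz_representation:
  fixes f :: "'a::{real_inner, complete_space} \<Rightarrow> real"
  assumes f: "bounded_linear f"
  shows "\<exists>v. \<forall>x. f x = inner x v"
proof -
  interpret f: bounded_linear f by (rule f)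
  define J where "J x = (norm x)\<^sup>2 / 2 - f x" for x
  obtain K where K: "\<And>x. norm (f x) \<le> norm x * K"
    using f.bounded by blast
  have lower: "- (K\<^sup>2 / 2) \<le> J x" for x
  proof -
    have "f x \<le> norm x * K" using K[of x] by simp
    moreover have "0 \<le> (norm x - K)\<^sup>2" by simp
    ultimately show ?thesis by (simp add: J_def power2_diff)
  qed
  define m where "m = (INF x. J x)"
  have bdd: "bdd_below (range J)" using lower by (auto intro!: bdd_belowI2)
  have m_le: "m \<le> J x" for x
    unfolding m_def by (rule cINF_lower[OF bdd]) simp
  have "\<exists>x. J x < m + e" if "e > 0" for e
    using that cINF_less_iff[OF _ bdd, of "m + e"] by (auto simp: m_def)
  then have "\<forall>n. \<exists>x. J x < m + inverse (real (Suc n))" by simp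
  then obtain X where X: "\<And>n. J (X n) < m + inverse (real (Suc n))" by metis
  have parallelogram: "(norm (x - y))\<^sup>2 = 4 * (J x + J y - 2 * J ((1/2) *\<^sub>R (x + y)))" for x y
    by (simp add: J_def f.scaleR f.add power2_norm_eq_inner inner_commute
        algebra_simps)
  have dist_le: "(norm (X i - X j))\<^sup>2 \<le> 4 * (inverse (real (Suc i)) + inverse (real (Suc j)))"
    for i j
    unfolding parallelogram using X[of i] X[of j] m_le[of "(1/2) *\<^sub>R (X i + X j)"] by argo
  have "Cauchy X"
  proof (rule CauchyI)
    fix e :: real assume "e > 0"
    then have "0 < e\<^sup>2 / 8" by simp
    then obtain N where N: "inverse (real (Suc N)) < e\<^sup>2 / 8"
      using reals_Archimedean by blast
    have "norm (X i - X j) < e" if "i \<ge> N" "j \<ge> N" for i j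
    proof -
      have "inverse (real (Suc k)) < e\<^sup>2 / 8" if "k \<ge> N" for k
        by (rule le_less_trans[OF le_imp_inverse_le N]) (use that in simp_all)
      from this[OF \<open>i \<ge> N\<close>] this[OF \<open>j \<ge> N\<close>] dist_le[of i j]
      have "(norm (X i - X j))\<^sup>2 < e\<^sup>2" by argo
      then show ?thesis using \<open>e > 0\<close> by (simp add: power_less_imp_less_base)
    qed
    then show "\<exists>M. \<forall>i\<ge>M. \<forall>j\<ge>M. norm (X i - X j) < e" by blast
  qed
  then obtain v where v: "X \<longlonglongrightarrow> v"
    using Cauchy_convergent convergent_def by blast
  have "(\<lambda>n. J (X n)) \<longlonglongrightarrow> J v"
    unfolding J_def by (intro tendsto_intros v f.tendsto) simp
  moreover have "(\<lambda>n. m + inverse (real (Suc n))) \<longlonglongrightarrow> m + 0"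
    by (intro tendsto_intros LIMSEQ_inverse_real_of_nat)
  ultimately have "J v \<le> m + 0"
    by (rule LIMSEQ_le) (use X less_imp_le in blast)
  then have Jv: "J v \<le> m" by simp
  have "f x = inner x v" for x
  proof -
    have "0 \<le> t * (inner x v - f x) + t\<^sup>2 * ((norm x)\<^sup>2 / 2)" for t
    proof -
      have "0 \<le> J (v + t *\<^sub>R x) - J v"
        using m_le[of "v + t *\<^sub>R x"] Jv by simp
      also have "\<dots> = t * (inner x v - f x) + t\<^sup>2 * ((norm x)\<^sup>2 / 2)"
        unfolding J_def power2_norm_eq_inner
        by (simp add: f.scaleR f.add inner_commute power2_eq_square algebra_simps)
      finally show ?thesis .
    qed
    then have "inner x v - f x = 0" by (rule linear_coeff_zero_if_quadratic_nonneg)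
    then show ?thesis by simp
  qed
  then show ?thesis by blast
qed

lemma bounded_linear_has_real_adjoint:
  fixes T :: "'a::{real_inner, complete_space} \<Rightarrow> 'b::real_inner"
  assumes "bounded_linear T"
  shows "\<exists>S. \<forall>x y. inner (T x) y = inner x (S y)"
proof -
  have "\<exists>v. \<forall>x. inner (T x) y = inner x v" for y
    by (intro riesz_representation bounded_linear_compose[OF bounded_linear_inner_left assms])
  then show ?thesis by metis
qed

text \<open>
  Since \<open>Im w = Re (- \<i> w)\<close>, the real inner product determines the complex one. This transports
  identities from real to complex Hilbert spaces.
\<close>

lemma cinner_eq_inner: "cinner x y = Complex (inner x y) (inner ((- \<i>) *\<^sub>C x) y)"
  by (simp add: complex_eq_iff inner_eq_Re_cinner cinner_scaleC_left)

lemma cinner_cadjoint: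
  fixes T :: "'a::complex_hilbert \<Rightarrow> 'b::complex_inner"
  assumes "bounded_clinear T"
  shows "cinner (T x) y = cinner x (cadjoint T y)"
proof -
  have T: "bounded_linear T" "\<And>c x. T (c *\<^sub>C x) = c *\<^sub>C T x"
    using assms by (auto simp: bounded_clinear_def)
  obtain S where S: "\<And>x y. inner (T x) y = inner x (S y)"
    using bounded_linear_has_real_adjoint[OF T(1)] by blast
  have "\<forall>x y. cinner (T x) y = cinner x (S y)"
    by (simp add: cinner_eq_inner S flip: T(2))
  then have "\<forall>x y. cinner (T x) y = cinner x (cadjoint T y)"
    unfolding cadjoint_def by (rule someI[of "\<lambda>S. \<forall>x y. cinner (T x) y = cinner x (S y)"])
  then show ?thesis by blast
qed

lemma cadjoint_eq_zero_if_surj: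
  fixes T :: "'a::complex_hilbert \<Rightarrow> 'b::complex_inner"
  assumes "bounded_clinear T" and "surj T" and "cadjoint T y = 0"
  shows "y = 0"
proof -
  obtain x where x: "T x = y" using \<open>surj T\<close> by (metis surjD)
  have "inner y y = inner x (cadjoint T y)"
    using cinner_cadjoint[OF assms(1), of x y] by (simp add: x inner_eq_Re_cinner)
  then show ?thesis using assms(3) by simp
qed

section \<open>Nonnegative operators and singular vectors\<close>

text \<open>
  The form \<open>\<langle>T u, u\<rangle>\<close> is minimal at \<open>x\<close>, so its derivative there in the direction \<open>T x\<close>, which
  is \<open>2 \<parallel>T x\<parallel>\<^sup>2\<close> by symmetry, vanishes.
\<close>

lemma nonnegative_selfadjoint_eq_zero:
  fixes T :: "'a::complex_hilbert \<Rightarrow> 'a"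
  assumes "selfadjoint T" and "nonnegative T" and zero: "cinner (T x) x = 0"
  shows "T x = 0"
proof -
  have T: "bounded_clinear T" "cadjoint T = T"
    using assms(1) by (auto simp: selfadjoint_def)
  interpret T: bounded_linear T using T(1) by (simp add: bounded_clinear_def)
  have sym: "inner (T u) v = inner u (T v)" for u v
    using cinner_cadjoint[OF T(1), of u v] T(2) by (simp add: inner_eq_Re_cinner)
  have nonneg: "0 \<le> inner (T u) u" for u
    using assms(2) by (simp add: nonnegative_def inner_eq_Re_cinner complex_nonneg_Reals_iff)
  have zero': "inner (T x) x = 0" using zero by (simp add: inner_eq_Re_cinner)
  have "0 \<le> t * (2 * inner (T x) (T x)) + t\<^sup>2 * inner (T (T x)) (T x)" for t
  proof -
    have "0 \<le> inner (T (x + t *\<^sub>R T x)) (x + t *\<^sub>R T x)" by (rule nonneg)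
    also have "\<dots> = t * (2 * inner (T x) (T x)) + t\<^sup>2 * inner (T (T x)) (T x)"
      using zero' sym[of "T x" x]
      by (simp add: T.add T.scaleR power2_eq_square algebra_simps)
    finally show ?thesis .
  qed
  then have "2 * inner (T x) (T x) = 0" by (rule linear_coeff_zero_if_quadratic_nonneg)
  then show ?thesis by simp
qed

lemma scaleC_zero_left [simp]: "0 *\<^sub>C (x::'a::complex_inner) = 0"
  using scaleC_of_real[of 0 x] by simp

lemma scaleC_one [simp]: "1 *\<^sub>C (x::'a::complex_inner) = x"
  using scaleC_of_real[of 1 x] by simp

lemma scaleC_zero_right [simp]: "c *\<^sub>C (0::'a::complex_inner) = 0"
  using scaleC_add_right[of c "0::'a" 0] by simp

lemma cinner_zero_left [simp]: "cinner 0 (x::'a::complex_inner) = 0"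
  using cinner_add_left[of 0 0 x] by simp

text \<open>
  For an everywhere defined \<open>E\<close> the exceptional convention for \<open>scale_op 0\<close> agrees with pointwise
  multiplication by \<open>0\<close>, so no case distinction on \<open>z\<close> remains.
\<close>

lemma pencil_total_left:
  "pencil (Some \<circ> E) A z x = (case A x of None \<Rightarrow> None | Some u \<Rightarrow> Some (z *\<^sub>C E x - u))"
  by (auto simp: pencil_def diff_op_def scale_op_def split: option.split)

lemma mem_point_singularities_total_left:
  "z \<in> point_singularities (Some \<circ> E) A \<longleftrightarrow> (\<exists>x. x \<noteq> 0 \<and> A x = Some (z *\<^sub>C E x))"
proof
  assume "\<exists>x. x \<noteq> 0 \<and> A x = Some (z *\<^sub>C E x)"
  then obtain x where "x \<noteq> 0" "A x = Some (z *\<^sub>C E x)" by blast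
  then show "z \<in> point_singularities (Some \<circ> E) A"
    by (auto simp: point_singularities_def pencil_total_left dom_def intro!: bexI[of _ x])
qed (auto simp: point_singularities_def pencil_total_left dom_def split: option.splits)

lemma right_singular_poly_total_left:
  "right_singular_poly (Some \<circ> E) A p \<longleftrightarrow>
     p \<noteq> 0 \<and> (\<forall>z. A (vpoly p z) = Some (z *\<^sub>C E (vpoly p z)))"
  by (auto simp: right_singular_poly_def pencil_total_left dom_def split: option.splits)

lemma singular_vector_in_right_half_plane:
  fixes E Q :: "'x::complex_hilbert \<Rightarrow> 'y::complex_inner"
  assumes "bounded_clinear Q" and "surj Q"
    and "selfadjoint (cadjoint Q \<circ> E)" and "nonnegative (cadjoint Q \<circ> E)"
    and "dissipative B"
    and "Re z > 0" and x: "B (Q x) = Some (z *\<^sub>C E x)"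
  shows "E x = 0"
proof -
  have "cinner (cadjoint Q (E x)) x \<in> \<real>\<^sub>\<ge>\<^sub>0"
    using assms(4) by (simp add: nonnegative_def)
  then obtain r where r: "r \<ge> 0" "cinner (cadjoint Q (E x)) x = of_real r"
    by (auto elim: nonneg_Reals_cases)
  have "cinner (E x) (Q x) = of_real r"
    using r(2) cinner_cadjoint[OF assms(1), of x "E x"]
    by (metis cinner_commute complex_cnj_complex_of_real)
  then have "Re (z * of_real r) \<le> 0"
    using assms(5) x by (force simp: dissipative_def cinner_scaleC_left)
  then have "r = 0"
    using r(1) \<open>Re z > 0\<close> by (simp add: mult_le_0_iff)
  then have "cadjoint Q (E x) = 0"
    using nonnegative_selfadjoint_eq_zero[OF assms(3,4), of x] r(2) by simp
  then show ?thesis by (rule cadjoint_eq_zero_if_surj[OF assms(1,2)])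
qed

section \<open>Zeros of vector-valued polynomials\<close>

lemma cinner_sum_left:
  fixes f :: "'b \<Rightarrow> 'a::complex_inner"
  shows "cinner (\<Sum>j\<in>A. f j) y = (\<Sum>j\<in>A. cinner (f j) y)"
  by (induction A rule: infinite_finite_induct) (simp_all add: cinner_add_left)

text \<open>
  Pairing with the leading coefficient turns the vector-valued polynomial into a scalar one whose
  leading coefficient is \<open>\<parallel>lead_coeff p\<parallel>\<^sup>2\<close>.
\<close>

lemma finite_zeros_vpoly:
  fixes p :: "'a::complex_inner poly"
  assumes "p \<noteq> 0"
  shows "finite {z. vpoly p z = 0}"
proof -
  define l where "l = lead_coeff p"
  define q where "q = (\<Sum>j\<le>degree p. monom (cinner (coeff p j) l) j)"
  have "poly q z = cinner (vpoly p z) l" for z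
    by (simp add: q_def vpoly_def poly_sum poly_monom cinner_sum_left cinner_scaleC_left
        mult.commute)
  then have sub: "{z. vpoly p z = 0} \<subseteq> {z. poly q z = 0}" by auto
  have "coeff q (degree p) = cinner l l"
    by (simp add: q_def l_def coeff_sum)
  moreover have "cinner l l \<noteq> 0"
    using assms inner_eq_Re_cinner[of l l] by (auto simp: l_def)
  ultimately have "q \<noteq> 0" by auto
  then show ?thesis using sub poly_roots_finite finite_subset by blast
qed

lemma vpoly_nonzero_in_right_half_plane:
  assumes "p \<noteq> 0"
  obtains z where "Re z > 0" and "vpoly p z \<noteq> 0"
proof -
  have "inj (\<lambda>n. of_nat (Suc n) :: complex)" by (auto simp: inj_on_def)
  then have "infinite (range (\<lambda>n. of_nat (Suc n) :: complex))"
    by (rule range_inj_infinite)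
  then have "\<not> range (\<lambda>n. of_nat (Suc n)) \<subseteq> {z. vpoly p z = 0}"
    using finite_zeros_vpoly[OF assms] finite_subset by blast
  then obtain n where "vpoly p (of_nat (Suc n)) \<noteq> 0" by auto
  then show ?thesis by (intro that) auto
qed

section \<open>Characterisation of singular dissipative pencils\<close>

theorem theorem43:
  fixes E Q :: "'x::complex_hilbert \<Rightarrow> 'y::complex_hilbert"
    and B :: "'y \<rightharpoonup> 'y"
  assumes "bounded_clinear E"
    and "bounded_clinear Q"
    and "boundedly_invertible Q"
    and "selfadjoint (cadjoint Q \<circ> E)"
    and "nonnegative (cadjoint Q \<circ> E)"
    and "linear_op B"
    and "closed_op B"
    and "densely_defined B"
    and "dissipative B"
  defines "a \<equiv> point_singularities (Some \<circ> E) (B \<circ> Q) = UNIV \<and>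
                infinity_point_singularity (Some \<circ> E) (B \<circ> Q)"
    and "b \<equiv> point_singularities (Some \<circ> E) (B \<circ> Q) \<inter> {z. Re z > 0} \<noteq> {}"
    and "c \<equiv> ker_op (Some \<circ> E) \<inter> ker_op (B \<circ> Q) \<noteq> {0}"
    and "d \<equiv> \<exists>p. right_singular_poly (Some \<circ> E) (B \<circ> Q) p"
  shows "(a \<longleftrightarrow> b) \<and> (b \<longleftrightarrow> c) \<and> (c \<longleftrightarrow> d)"
proof -
  note E = assms(1) and Q = assms(2) and B = \<open>linear_op B\<close>
  have "surj Q"
    using assms(3) unfolding boundedly_invertible_def by (metis surjI)
  have E0: "E 0 = 0" and Q0: "Q 0 = 0"
    using E Q by (simp_all add: bounded_clinear_def linear_simps)
  have B0: "B 0 = Some 0"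
    using B by (simp add: linear_op_def)
  have kernel: "E x = 0" "B (Q x) = Some 0" if "Re z > 0" "B (Q x) = Some (z *\<^sub>C E x)" for x z
    using singular_vector_in_right_half_plane[OF Q \<open>surj Q\<close> assms(4,5,9) that] that(2) by simp_all
  \<comment> \<open>Both kernels contain \<open>0\<close>, so differing from \<open>{0}\<close> means having a nonzero element.\<close>
  have c_iff: "c \<longleftrightarrow> (\<exists>x. x \<noteq> 0 \<and> E x = 0 \<and> B (Q x) = Some 0)"
    unfolding c_def ker_op_def using E0 Q0 B0 by fastforce
  have b_iff: "b \<longleftrightarrow> (\<exists>z x. Re z > 0 \<and> x \<noteq> 0 \<and> B (Q x) = Some (z *\<^sub>C E x))"
    by (auto simp: b_def set_eq_iff mem_point_singularities_total_left)
  have bc: "c" if "b"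
    using that kernel unfolding b_iff c_iff by blast
  have ca: "a" if c: "c"
  proof -
    obtain x where x: "x \<noteq> 0" "E x = 0" "B (Q x) = Some 0" using c c_iff by blast
    then have "point_singularities (Some \<circ> E) (B \<circ> Q) = UNIV"
      by (auto simp: mem_point_singularities_total_left intro!: exI[of _ x])
    moreover have "infinity_point_singularity (Some \<circ> E) (B \<circ> Q)"
      using x by (auto simp: infinity_point_singularity_def point_singularities_def pencil_def
          diff_op_def scale_op_def dom_def intro!: bexI[of _ x])
    ultimately show ?thesis by (simp add: a_def)
  qed
  have ab: "b" if "a"
    using that unfolding a_def b_def by (auto intro!: exI[of _ 1])
  have cd: "d" if c: "c"
  proof -
    obtain x where x: "x \<noteq> 0" "E x = 0" "B (Q x) = Some 0" using c c_iff by blast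
    then have "right_singular_poly (Some \<circ> E) (B \<circ> Q) [:x:]"
      by (simp add: right_singular_poly_total_left vpoly_def)
    then show ?thesis unfolding d_def by blast
  qed
  have db: "b" if d: "d"
  proof -
    obtain p where p: "p \<noteq> 0" "\<And>z. B (Q (vpoly p z)) = Some (z *\<^sub>C E (vpoly p z))"
      using d by (auto simp: d_def right_singular_poly_total_left)
    obtain z where "Re z > 0" "vpoly p z \<noteq> 0"
      using vpoly_nonzero_in_right_half_plane[OF p(1)] .
    then show ?thesis using p(2) b_iff by blast
  qed
  show ?thesis using ab bc ca cd db by blast
qed

end
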